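(* Fix a real $\gamma\in(0,1)$. Let $x_0\in\mathcal{T}_\gamma$, and let $\{x_k\}$ be any sequence of iterates generated by the Polyak subgradient method initialized at $x_0$: at step $k\ge 0$, choose any $\zeta_k\in\partial g(x_k)$; if $\zeta_k=0$, the algorithm stops; otherwise set $$x_{k+1}=\mathrm{proj}_{\mathcal{X}}\left(x_k-\frac{g(x_k)-\min_{\mathcal{X}}g}{\|\zeta_k\|^2}\,\zeta_k\right).$$ Then the iterates converge $Q$-linearly to $\mathcal{X}^*$, in the sense that for every $k\ge 0$ for which $x_{k+1}$ is generated, $$\mathrm{dist}^2(x_{k+1};\mathcal{X}^* )\le\left(1-(1-\gamma)\tau^2\right)\mathrm{dist}^2(x_k;\mathcal{X}^* ).$$
   Context: $\mathbb{R}^d$ carries the Euclidean inner product and norm. For a set $\mathcal{Y}$, $\mathrm{dist}(y;\mathcal{Y})=\inf_{x\in\mathcal{Y}}\|y-x\|$, and $\mathrm{proj}_{\mathcal{Y}}(y)$ is the set of nearest points of $\mathcal{Y}$ to $y$ (a single point when $\mathcal{Y}$ is nonempty, closed and convex). Standing setting: consider $\min_{x\in\mathcal{X}}g(x)$, with fixed reals $\mu,\rho>0$, such that: (1) $g:\mathbb{R}^d\to\mathbb{R}$ is $\rho$-weakly convex, i.e. $x\mapsto g(x)+\frac{\rho}{2}\|x\|^2$ is convex; $\mathcal{X}\subset\mathbb{R}^d$ is closed and convex; and the set of minimizers $\mathcal{X}^*:=\mathrm{argmin}_{x\in\mathcal{X}}g(x)$ is nonempty. (2) (Sharpness) $g(x)-\min_{\mathcal{X}}g\ge\mu\cdot\mathrm{dist}(x;\mathcal{X}^*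 )$ for all $x\in\mathcal{X}$. The subdifferential $\partial g(x)$ is the set of all $v\in\mathbb{R}^d$ with $g(y)\ge g(x)+\langle v,y-x\rangle+o(\|y-x\|)$ as $y\to x$; for $\rho$-weakly convex $g$ this is equivalent to $g(y)\ge g(x)+\langle v,y-x\rangle-\frac{\rho}{2}\|y-x\|^2$ for all $y\in\mathbb{R}^d$. For $\gamma>0$, $\mathcal{T}_\gamma:=\{x\in\mathcal{X}:\mathrm{dist}(x;\mathcal{X}^* )<\gamma\mu/\rho\}$. Set $L:=\sup\{\|\zeta\|:\zeta\in\partial g(x),\ x\in\mathcal{T}_1\}$ and $\tau:=\mu/L$, where $\tau\in[0,1]$ (with $\tau=0$ if $L=+\infty$). *)

theory Defs
  imports "HOL-Analysis.Analysis" "HOL-Library.Landau_Symbols"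
begin

definition weakly_convex :: "real \<Rightarrow> ('a::euclidean_space \<Rightarrow> real) \<Rightarrow> bool" where
  "weakly_convex \<rho> g \<longleftrightarrow> convex_on UNIV (\<lambda>x. g x + \<rho> / 2 * (norm x)\<^sup>2)"

definition minimizers :: "('a \<Rightarrow> real) \<Rightarrow> 'a set \<Rightarrow> 'a set" where
  "minimizers g X = {x. is_arg_min g (\<lambda>x. x \<in> X) x}"

(* Meant for the case that the minimum over X is attained; the infimum of the
   conditionally complete order on the reals is then the minimum. *)
definition min_value :: "('a \<Rightarrow> real) \<Rightarrow> 'a set \<Rightarrow> real" where
  "min_value g X = (INF x\<in>X. g x)"

definition sharp :: "real \<Rightarrow> ('a::metric_space \<Rightarrow> real) \<Rightarrow> 'a set \<Rightarrow> bool" where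
  "sharp \<mu> g X \<longleftrightarrow> (\<forall>x\<in>X. g x - min_value g X \<ge> \<mu> * infdist x (minimizers g X))"

(* The function r is the o(norm (y - x)) term of the defining inequality. *)
definition subdifferential :: "('a::euclidean_space \<Rightarrow> real) \<Rightarrow> 'a \<Rightarrow> 'a set" where
  "subdifferential g x =
     {v. \<exists>r :: 'a \<Rightarrow> real. r \<in> o[at x](\<lambda>y. norm (y - x)) \<and>
           (\<forall>\<^sub>F y in at x. g y \<ge> g x + v \<bullet> (y - x) + r y)}"

definition tube :: "('a::metric_space \<Rightarrow> real) \<Rightarrow> 'a set \<Rightarrow> real \<Rightarrow> real \<Rightarrow> real \<Rightarrow> 'a set" where
  "tube g X \<mu> \<rho> \<gamma> = {x \<in> X. infdist x (minimizers g X) < \<gamma> * \<mu> / \<rho>}"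

definition subgrad_bound :: "('a::euclidean_space \<Rightarrow> real) \<Rightarrow> 'a set \<Rightarrow> real \<Rightarrow> real \<Rightarrow> ereal" where
  "subgrad_bound g X \<mu> \<rho> =
     Sup {ereal (norm \<zeta>) | \<zeta> x. x \<in> tube g X \<mu> \<rho> 1 \<and> \<zeta> \<in> subdifferential g x}"

(* In ereal, division by infinity gives 0, so an infinite subgradient bound yields 0.
   A zero bound also yields 0 (real_of_ereal sends infinity to 0); under sharpness
   this can occur only when every point of X is a minimizer. *)
definition cond_number :: "('a::euclidean_space \<Rightarrow> real) \<Rightarrow> 'a set \<Rightarrow> real \<Rightarrow> real \<Rightarrow> real" where
  "cond_number g X \<mu> \<rho> = real_of_ereal (ereal \<mu> / subgrad_bound g X \<mu> \<rho>)"

(* The method stops at the first k with \<zeta> k = 0, so x k is generated iff all earlier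
   subgradients are nonzero. The sequences are total functions, but their
   values after stopping are unconstrained and carry no meaning. *)
definition generated :: "(nat \<Rightarrow> 'a::zero) \<Rightarrow> nat \<Rightarrow> bool" where
  "generated \<zeta> k \<longleftrightarrow> (\<forall>j<k. \<zeta> j \<noteq> 0)"

definition polyak_iterates ::
  "('a::euclidean_space \<Rightarrow> real) \<Rightarrow> 'a set \<Rightarrow> (nat \<Rightarrow> 'a) \<Rightarrow> (nat \<Rightarrow> 'a) \<Rightarrow> bool" where
  "polyak_iterates g X x \<zeta> \<longleftrightarrow>
     (\<forall>k. generated \<zeta> k \<longrightarrow>
        \<zeta> k \<in> subdifferential g (x k) \<and>
        (\<zeta> k \<noteq> 0 \<longrightarrow>
           x (Suc k) =
             closest_point X (x k - ((g (x k) - min_value g X) / (norm (\<zeta> k))\<^sup>2) *\<^sub>R \<zeta> k)))"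

end

theory Submission
  imports Defs
begin

text \<open>
  Let \<open>p\<close> be a minimizer nearest to \<open>x\<close>, let \<open>d = \<parallel>x - p\<parallel>\<close> and let \<open>\<Delta>\<close> be the gap between
  \<open>g x\<close> and the minimum. Projecting onto \<open>X\<close> does not increase the distance to \<open>p\<close>, so expanding the
  square after a step of length \<open>\<Delta> / \<parallel>\<zeta>\<parallel>\<^sup>2\<close> and inserting the subgradient inequality
  (lemma \<open>subgradient_inequality\<close>) leaves
  \<open>dist\<^sup>2 \<le> d\<^sup>2 - \<Delta> (\<Delta> - \<rho> d\<^sup>2) / \<parallel>\<zeta>\<parallel>\<^sup>2\<close> (lemma \<open>polyak_step_le\<close>).
  The term \<open>\<rho> d\<^sup>2\<close> is the price of nonconvexity, and sharpness pays for it inside the tube: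
  there \<open>\<rho> d\<^sup>2 \<le> \<gamma> \<mu> d \<le> \<gamma> \<Delta>\<close>. What remains is a decrease of
  \<open>(1 - \<gamma>) \<Delta>\<^sup>2 / \<parallel>\<zeta>\<parallel>\<^sup>2 \<ge> (1 - \<gamma>) (\<mu> d / \<parallel>\<zeta>\<parallel>)\<^sup>2\<close>, and \<open>\<mu> / \<parallel>\<zeta>\<parallel>\<close> is at least the condition
  number because \<open>\<parallel>\<zeta>\<parallel>\<close> is at most the subgradient bound (lemma \<open>polyak_contraction\<close>).
  In particular the distance to the minimizers never grows, so the iterates stay in the tube and
  the estimate applies at every step.
\<close>

lemma minimizers_iff: "p \<in> minimizers g X \<longleftrightarrow> p \<in> X \<and> (\<forall>y\<in>X. g p \<le> g y)"
  for g :: "'a \<Rightarrow> real"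
  by (auto simp: minimizers_def is_arg_min_def not_less)

lemma min_value_eq:
  fixes g :: "'a \<Rightarrow> real"
  assumes "p \<in> minimizers g X"
  shows "min_value g X = g p"
  unfolding min_value_def
  using assms by (intro cInf_eq_minimum) (auto simp: minimizers_iff)

lemma weakly_convex_continuous:
  fixes g :: "'a::euclidean_space \<Rightarrow> real"
  assumes "weakly_convex \<rho> g"
  shows "continuous_on UNIV g"
proof -
  have "continuous_on UNIV (\<lambda>x. g x + \<rho> / 2 * (norm x)\<^sup>2)"
    using assms unfolding weakly_convex_def by (intro convex_on_continuous) auto
  then have "continuous_on UNIV (\<lambda>x. (g x + \<rho> / 2 * (norm x)\<^sup>2) - \<rho> / 2 * (norm x)\<^sup>2)"
    by (rule continuous_on_diff) (intro continuous_intros)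
  then show ?thesis by simp
qed

text \<open>Closedness guarantees that a nearest minimizer exists.\<close>

lemma closed_minimizers:
  fixes g :: "'a::euclidean_space \<Rightarrow> real"
  assumes "continuous_on UNIV g" and "closed X"
  shows "closed (minimizers g X)"
proof -
  have "minimizers g X = X \<inter> (\<Inter>y\<in>X. {p. g p \<le> g y})"
    by (auto simp: minimizers_iff)
  moreover have "closed {p. g p \<le> g y}" for y
    using assms(1) by (intro closed_Collect_le continuous_intros)
  ultimately show ?thesis using assms(2) by (simp add: closed_Int closed_INT)
qed

text \<open>Along a segment the squared norm falls short of its chord by exactly \<open>s (1 - s) \<parallel>y - x\<parallel>\<^sup>2\<close>, so
  moving the quadratic term to the right-hand side of the convexity inequality relaxes it by
  \<open>\<rho> / 2\<close> times this amount.\<close>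

lemma weakly_convex_on_segment:
  fixes g :: "'a::euclidean_space \<Rightarrow> real"
  assumes "weakly_convex \<rho> g" and "0 \<le> s" and "s \<le> 1"
  shows "g (x + s *\<^sub>R (y - x))
           \<le> (1 - s) * g x + s * g y + \<rho> / 2 * (s * (1 - s) * (norm (y - x))\<^sup>2)"
proof -
  define z where "z = x + s *\<^sub>R (y - x)"
  have z: "z = (1 - s) *\<^sub>R x + s *\<^sub>R y" by (simp add: z_def algebra_simps)
  have conv: "g z + \<rho> / 2 * (norm z)\<^sup>2
      \<le> (1 - s) * (g x + \<rho> / 2 * (norm x)\<^sup>2) + s * (g y + \<rho> / 2 * (norm y)\<^sup>2)"
    unfolding z using assms unfolding weakly_convex_def
    by (intro convex_onD) auto
  have norm_z: "(norm z)\<^sup>2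
      = (1 - s) * (norm x)\<^sup>2 + s * (norm y)\<^sup>2 - s * (1 - s) * (norm (y - x))\<^sup>2"
    unfolding z_def power2_norm_eq_inner
    by (simp add: algebra_simps inner_commute power2_eq_square)
  show ?thesis
    using conv unfolding z_def[symmetric] norm_z
    by (simp add: algebra_simps add_divide_distrib diff_divide_distrib)
qed

text \<open>The local expansion at \<open>x\<close> is tested at the points \<open>x + s (y - x)\<close> for small
  \<open>s > 0\<close>. The error term of the expansion is \<open>o(s)\<close> there, so it becomes negligible after the
  segment inequality is divided by \<open>s\<close>, and the local inequality turns into a global one.\<close>

lemma subgradient_inequality:
  fixes g :: "'a::euclidean_space \<Rightarrow> real"
  assumes wc: "weakly_convex \<rho> g" and "0 \<le> \<rho>" and v: "v \<in> subdifferential g x"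
  shows "g y \<ge> g x + v \<bullet> (y - x) - \<rho> / 2 * (norm (y - x))\<^sup>2"
proof (cases "y = x")
  case False
  define n where "n = norm (y - x)"
  have n: "n > 0" using False by (simp add: n_def)
  obtain r :: "'a \<Rightarrow> real" where r: "r \<in> o[at x](\<lambda>y. norm (y - x))"
    and ev: "\<forall>\<^sub>F y in at x. g y \<ge> g x + v \<bullet> (y - x) + r y"
    using v unfolding subdifferential_def by auto
  have "g x + v \<bullet> (y - x) - \<rho> / 2 * n\<^sup>2 \<le> g y + e" if "e > 0" for e
  proof -
    have "\<forall>\<^sub>F z in at x. norm (r z) \<le> e / n * norm (norm (z - x))"
      using n \<open>e > 0\<close> by (intro landau_o.smallD[OF r]) simp
    with ev have "\<forall>\<^sub>F z in at x. g z \<ge> g x + v \<bullet> (z - x) - e / n * norm (z - x)"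
      by eventually_elim auto
    then obtain \<delta> where \<delta>: "\<delta> > 0"
      and le: "\<And>z. z \<noteq> x \<Longrightarrow> dist z x < \<delta> \<Longrightarrow> g z \<ge> g x + v \<bullet> (z - x) - e / n * norm (z - x)"
      unfolding eventually_at by blast
    define s where "s = min 1 (\<delta> / (2 * n))"
    have s: "0 < s" "s \<le> 1" using \<delta> n by (auto simp: s_def)
    have "s * n \<le> \<delta> / (2 * n) * n" using n by (intro mult_right_mono) (auto simp: s_def)
    then have sn: "s * n < \<delta>" using \<delta> n by simp
    let ?z = "x + s *\<^sub>R (y - x)"
    have "g x + v \<bullet> (?z - x) - e / n * norm (?z - x) \<le> g ?z"
      using s sn False by (intro le) (auto simp: dist_norm n_def)
    moreover have "e / n * norm (?z - x) = s * e"
      using n s by (simp add: n_def)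
    ultimately have "g x + s * (v \<bullet> (y - x)) - s * e \<le> g ?z" by simp
    also have "\<dots> \<le> (1 - s) * g x + s * g y + \<rho> / 2 * (s * (1 - s) * n\<^sup>2)"
      unfolding n_def using s by (intro weakly_convex_on_segment[OF wc]) auto
    also have "\<dots> \<le> (1 - s) * g x + s * g y + \<rho> / 2 * (s * n\<^sup>2)"
      using s \<open>0 \<le> \<rho>\<close> by (intro add_left_mono mult_left_mono mult_right_mono) auto
    finally have "s * (g x + v \<bullet> (y - x) - \<rho> / 2 * n\<^sup>2) \<le> s * (g y + e)"
      by (simp add: algebra_simps)
    then show ?thesis using s by simp
  qed
  then show ?thesis unfolding n_def by (rule field_le_epsilon)
qed simp

text \<open>The Polyak step length minimizes the bound
  \<open>\<parallel>x - p\<parallel>\<^sup>2 - 2 t \<Delta> + t\<^sup>2 \<parallel>z\<parallel>\<^sup>2\<close> over \<open>t\<close>, which is the one that convexity would give. Weak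
  convexity adds \<open>t \<rho> \<parallel>x - p\<parallel>\<^sup>2\<close>.\<close>

lemma polyak_step_le:
  fixes g :: "'a::euclidean_space \<Rightarrow> real"
  assumes wc: "weakly_convex \<rho> g" and "0 \<le> \<rho>"
    and X: "closed X" "convex X"
    and p: "p \<in> minimizers g X"
    and x: "x \<in> X"
    and z: "z \<in> subdifferential g x" "z \<noteq> 0"
    and D: "\<Delta> = g x - min_value g X"
  shows "(dist (closest_point X (x - (\<Delta> / (norm z)\<^sup>2) *\<^sub>R z)) p)\<^sup>2
           \<le> (dist x p)\<^sup>2 - \<Delta> * (\<Delta> - \<rho> * (dist x p)\<^sup>2) / (norm z)\<^sup>2"
proof -
  define t where "t = \<Delta> / (norm z)\<^sup>2"
  let ?y = "x - t *\<^sub>R z"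
  have pX: "p \<in> X" using p by (simp add: minimizers_iff)
  have mv: "min_value g X = g p" by (rule min_value_eq[OF p])
  have "\<Delta> \<ge> 0" using p x D mv by (simp add: minimizers_iff)
  then have t: "t \<ge> 0" by (simp add: t_def)
  have tz: "t * (norm z)\<^sup>2 = \<Delta>" using z(2) by (simp add: t_def)
  have "dist (closest_point X ?y) p \<le> dist ?y p"
    using closest_point_lipschitz[OF X(2,1), of ?y p] pX by (auto simp: closest_point_self)
  then have "(dist (closest_point X ?y) p)\<^sup>2 \<le> (dist ?y p)\<^sup>2"
    by (intro power_mono) auto
  also have "\<dots> = (dist x p)\<^sup>2 + 2 * t * (z \<bullet> (p - x)) + t * (t * (norm z)\<^sup>2)"
    unfolding dist_norm power2_norm_eq_inner
    by (simp add: algebra_simps inner_commute power2_eq_square)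
  also have "\<dots> \<le> (dist x p)\<^sup>2 + 2 * t * (\<rho> / 2 * (dist x p)\<^sup>2 - \<Delta>) + t * \<Delta>"
  proof -
    have "z \<bullet> (p - x) \<le> \<rho> / 2 * (dist x p)\<^sup>2 - \<Delta>"
      using subgradient_inequality[OF wc \<open>0 \<le> \<rho>\<close> z(1), of p] D mv
      by (simp add: dist_norm norm_minus_commute)
    then have "2 * t * (z \<bullet> (p - x)) \<le> 2 * t * (\<rho> / 2 * (dist x p)\<^sup>2 - \<Delta>)"
      using t by (intro mult_left_mono) auto
    then show ?thesis by (simp only: tz)
  qed
  also have "\<dots> = (dist x p)\<^sup>2 - t * (\<Delta> - \<rho> * (dist x p)\<^sup>2)"
    by (simp add: algebra_simps)
  finally show ?thesis by (simp add: t_def)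
qed

text \<open>The existence of a nonzero subgradient in the tube excludes the degenerate value \<open>0\<close>
  of the subgradient bound, and an infinite bound gives the condition number \<open>0\<close>.\<close>

lemma cond_number_bounds:
  fixes g :: "'a::euclidean_space \<Rightarrow> real"
  assumes "\<mu> > 0" and x: "x \<in> tube g X \<mu> \<rho> 1"
    and z: "z \<in> subdifferential g x" "z \<noteq> 0"
  shows "0 \<le> cond_number g X \<mu> \<rho>" and "cond_number g X \<mu> \<rho> \<le> \<mu> / norm z"
proof -
  have le: "ereal (norm z) \<le> subgrad_bound g X \<mu> \<rho>"
    unfolding subgrad_bound_def using x z(1) by (intro Sup_upper) blast
  have "0 \<le> cond_number g X \<mu> \<rho> \<and> cond_number g X \<mu> \<rho> \<le> \<mu> / norm z"
  proof (cases "subgrad_bound g X \<mu> \<rho>")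
    case (real l)
    with le z(2) have "norm z \<le> l" "0 < norm z" by auto
    then have "0 < l" by linarith
    have "\<mu> / l \<le> \<mu> / norm z" and "0 \<le> \<mu> / l"
      using \<open>\<mu> > 0\<close> \<open>norm z \<le> l\<close> \<open>0 < norm z\<close> \<open>0 < l\<close> by (simp_all add: frac_le)
    then show ?thesis using real \<open>0 < norm z\<close> \<open>norm z \<le> l\<close>
      by (simp add: cond_number_def)
  next
    case PInf
    then show ?thesis using \<open>\<mu> > 0\<close> by (simp add: cond_number_def)
  next
    case MInf
    then show ?thesis using le by simp
  qed
  then show "0 \<le> cond_number g X \<mu> \<rho>" and "cond_number g X \<mu> \<rho> \<le> \<mu> / norm z" by auto
qed

lemma polyak_contraction:
  fixes g :: "'a::euclidean_space \<Rightarrow> real"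
  assumes "\<mu> > 0" and "\<rho> > 0"
    and wc: "weakly_convex \<rho> g"
    and X: "closed X" "convex X"
    and ne: "minimizers g X \<noteq> {}"
    and sh: "sharp \<mu> g X"
    and "\<gamma> < 1"
    and x: "x \<in> tube g X \<mu> \<rho> \<gamma>"
    and z: "z \<in> subdifferential g x" "z \<noteq> 0"
    and x': "x' = closest_point X (x - ((g x - min_value g X) / (norm z)\<^sup>2) *\<^sub>R z)"
  shows "(infdist x' (minimizers g X))\<^sup>2
           \<le> (1 - (1 - \<gamma>) * (cond_number g X \<mu> \<rho>)\<^sup>2) * (infdist x (minimizers g X))\<^sup>2"
proof -
  define d where "d = infdist x (minimizers g X)"
  define \<Delta> where "\<Delta> = g x - min_value g X"
  let ?\<tau> = "cond_number g X \<mu> \<rho>"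
  have xX: "x \<in> X" and dt: "d < \<gamma> * \<mu> / \<rho>" using x by (auto simp: tube_def d_def)
  have d0: "d \<ge> 0" by (simp add: d_def infdist_nonneg)
  have "closed (minimizers g X)"
    using closed_minimizers weakly_convex_continuous wc X(1) by blast
  then obtain p where p: "p \<in> minimizers g X" and dp: "d = dist x p"
    using infdist_attains_inf[OF _ ne, of x] unfolding d_def by metis
  have "\<mu> * d \<le> \<Delta>" using sh xX by (auto simp: sharp_def d_def \<Delta>_def)
  have "0 \<le> \<mu> * d" using d0 \<open>\<mu> > 0\<close> by simp
  have "\<rho> * d < \<gamma> * \<mu>" using dt \<open>\<rho> > 0\<close> by (simp add: field_simps)
  have "\<gamma> \<ge> 0"
  proof -
    have "0 \<le> \<rho> * d" using d0 \<open>\<rho> > 0\<close> by simp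
    with \<open>\<rho> * d < \<gamma> * \<mu>\<close> have "0 < \<gamma> * \<mu>" by linarith
    with \<open>\<mu> > 0\<close> show ?thesis by (simp add: zero_less_mult_iff)
  qed
  have "\<rho> * d\<^sup>2 \<le> \<gamma> * (\<mu> * d)"
    using mult_right_mono[OF less_imp_le[OF \<open>\<rho> * d < \<gamma> * \<mu>\<close>] d0] by (simp add: power2_eq_square mult.assoc)
  also have "\<dots> \<le> \<gamma> * \<Delta>" using \<open>\<mu> * d \<le> \<Delta>\<close> \<open>\<gamma> \<ge> 0\<close> by (rule mult_left_mono)
  finally have price: "\<rho> * d\<^sup>2 \<le> \<gamma> * \<Delta>" .
  have "x \<in> tube g X \<mu> \<rho> 1"
  proof -
    have "\<gamma> * \<mu> / \<rho> \<le> 1 * \<mu> / \<rho>"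
      using \<open>\<gamma> < 1\<close> \<open>\<mu> > 0\<close> \<open>\<rho> > 0\<close> by (intro divide_right_mono mult_right_mono) auto
    then show ?thesis using dt xX by (simp add: tube_def d_def)
  qed
  note \<tau> = cond_number_bounds[OF \<open>\<mu> > 0\<close> this z]
  have "?\<tau> * d \<le> \<mu> / norm z * d" using \<tau>(2) d0 by (rule mult_right_mono)
  also have "\<dots> \<le> \<Delta> / norm z"
    using \<open>\<mu> * d \<le> \<Delta>\<close> by (simp add: divide_right_mono)
  finally have "(?\<tau> * d)\<^sup>2 \<le> (\<Delta> / norm z)\<^sup>2" using \<tau>(1) d0 by (intro power_mono) auto
  then have "(1 - \<gamma>) * (?\<tau> * d)\<^sup>2 \<le> (1 - \<gamma>) * (\<Delta> / norm z)\<^sup>2"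
    using \<open>\<gamma> < 1\<close> by (intro mult_left_mono) auto
  also have "\<dots> = \<Delta> * ((1 - \<gamma>) * \<Delta>) / (norm z)\<^sup>2" by (simp add: power2_eq_square)
  also have "\<dots> \<le> \<Delta> * (\<Delta> - \<rho> * d\<^sup>2) / (norm z)\<^sup>2"
    using price \<open>\<mu> * d \<le> \<Delta>\<close> \<open>0 \<le> \<mu> * d\<close>
    by (intro divide_right_mono mult_left_mono) (auto simp: algebra_simps)
  finally have dec: "(1 - \<gamma>) * (?\<tau> * d)\<^sup>2 \<le> \<Delta> * (\<Delta> - \<rho> * d\<^sup>2) / (norm z)\<^sup>2" .
  have "(infdist x' (minimizers g X))\<^sup>2 \<le> (dist x' p)\<^sup>2"
    using p by (intro power_mono infdist_le infdist_nonneg)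
  also have "\<dots> \<le> d\<^sup>2 - \<Delta> * (\<Delta> - \<rho> * d\<^sup>2) / (norm z)\<^sup>2"
    unfolding x' dp using \<open>\<rho> > 0\<close>
    by (fold \<Delta>_def) (intro polyak_step_le[OF wc _ X p xX z \<Delta>_def], simp)
  also have "\<dots> \<le> d\<^sup>2 - (1 - \<gamma>) * (?\<tau> * d)\<^sup>2" using dec by simp
  also have "\<dots> = (1 - (1 - \<gamma>) * ?\<tau>\<^sup>2) * d\<^sup>2" by (simp add: algebra_simps power_mult_distrib)
  finally show ?thesis by (simp add: d_def)
qed

theorem theorem3p1:
  fixes g :: "'a::euclidean_space \<Rightarrow> real"
    and X :: "'a set"
    and \<mu> \<rho> \<gamma> :: real
    and x \<zeta> :: "nat \<Rightarrow> 'a"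
  assumes "\<mu> > 0" and "\<rho> > 0"
    and "weakly_convex \<rho> g"
    and "closed X" and "convex X"
    and "minimizers g X \<noteq> {}"
    and "sharp \<mu> g X"
    and "0 < \<gamma>" and "\<gamma> < 1"
    and "x 0 \<in> tube g X \<mu> \<rho> \<gamma>"
    and "polyak_iterates g X x \<zeta>"
  shows "\<forall>k. generated \<zeta> (Suc k) \<longrightarrow>
           (infdist (x (Suc k)) (minimizers g X))\<^sup>2
             \<le> (1 - (1 - \<gamma>) * (cond_number g X \<mu> \<rho>)\<^sup>2) * (infdist (x k) (minimizers g X))\<^sup>2"
proof -
  let ?S = "minimizers g X" and ?\<tau> = "cond_number g X \<mu> \<rho>"
  have step: "\<zeta> k \<in> subdifferential g (x k)" "\<zeta> k \<noteq> 0"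
    "x (Suc k) = closest_point X (x k - ((g (x k) - min_value g X) / (norm (\<zeta> k))\<^sup>2) *\<^sub>R \<zeta> k)"
    if "generated \<zeta> (Suc k)" for k
    using that assms(11) by (auto simp: generated_def polyak_iterates_def)
  have contraction: "(infdist (x (Suc k)) ?S)\<^sup>2 \<le> (1 - (1 - \<gamma>) * ?\<tau>\<^sup>2) * (infdist (x k) ?S)\<^sup>2"
    if "generated \<zeta> (Suc k)" "x k \<in> tube g X \<mu> \<rho> \<gamma>" for k
    using polyak_contraction[OF assms(1-7,9) that(2) step[OF that(1)]] .
  have "x k \<in> tube g X \<mu> \<rho> \<gamma>" if "generated \<zeta> k" for k
    using that
  proof (induction k)
    case 0
    show ?case by (rule assms(10))
  next
    case (Suc k)
    have "generated \<zeta> k" using Suc.prems by (simp add: generated_def)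
    then have xk: "x k \<in> tube g X \<mu> \<rho> \<gamma>" by (rule Suc.IH)
    have "(infdist (x (Suc k)) ?S)\<^sup>2 \<le> (1 - (1 - \<gamma>) * ?\<tau>\<^sup>2) * (infdist (x k) ?S)\<^sup>2"
      by (rule contraction[OF Suc.prems xk])
    also have "\<dots> \<le> 1 * (infdist (x k) ?S)\<^sup>2"
      using assms(9) by (intro mult_right_mono) auto
    finally have "(infdist (x (Suc k)) ?S)\<^sup>2 \<le> (infdist (x k) ?S)\<^sup>2" by simp
    then have "infdist (x (Suc k)) ?S \<le> infdist (x k) ?S"
      by (rule power2_le_imp_le[OF _ infdist_nonneg])
    moreover have "x (Suc k) \<in> X"
      unfolding step(3)[OF Suc.prems]
      using assms(4) xk by (intro closest_point_in_set) (auto simp: tube_def)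
    ultimately show ?case using xk by (auto simp: tube_def)
  qed
  moreover have "generated \<zeta> k" if "generated \<zeta> (Suc k)" for k
    using that by (simp add: generated_def)
  ultimately show ?thesis using contraction by blast
qed

end
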